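(* Let $A$ be an arbitrary, possibly infinite, non-empty set. For any set $\mathcal{T}$ of clusters on $A$, the following two conditions are equivalent: (i) $\mathcal{T}$ is locally closed and contains the binary equality cluster, the unary empty cluster, and all unary trivial clusters of breadth $p\ge0$, and it is closed under formation of conjunctive minors, unions, quotients, and dividends. (ii) $\mathcal{T}$ is characterized by some set of operations on $A$.
   Context: $\mathbb{N}$ is the set of nonnegative integers; $m\in\mathbb{N}$ is identified with $\{0,\dots,m-1\}$, and an $m$-tuple over $A$ is a map $m\to A$. An operation on $A$ is a map $f\colon A^n\to A$ with $n\ge1$. Multisets and clusters. A finite multiset $S$ on a set $X$ is a multiplicity function $\nu_S\colon X\to\mathbb{N}$ with $|S|:=\sum_x\nu_S(x)<\infty$; $S'\subseteq S$ means $\nu_{S'}\le\nu_S$ pointwise; $S\uplus S'$ has multiplicity function $\nu_S+\nu_{S'}$; $\mathcal{M}(X)$ is the set of all finite multisets on $X$ (including the empty multiset $\varepsilon$). For an integer $m\ge1$, an $m$-ary cluster on $A$ is a subset $\Phi\subseteq\mathcal{M}(A^m)$ such that $S\in\Phi$ and $T\subseteq S$ imply $T\in\Phi$. Matrices and satisfaction. An $m\times n$ matrix over $A$ is an $n$-tuple $\mathbf{M}=(\mathbf{a}^1,\dots,\mathbf{a}^n)$ of $m$-tuples over $A$ (its columns); the empty matrix has no columns. $\mathbf{M}^*$ is the multiset of columns of $\mathbf{M}$; $\mathbf{M}\prec\Phi$ means $\mathbf{M}^*\in\Phi$. $[\mathbf{M}_1|\mathbf{M}_2]$ is juxtaposition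 of columns. For $f\colon A^n\to A$, $f\mathbf{M}$ is the $m$-tuple $i\mapsto f(\mathbf{a}^1(i),\dots,\mathbf{a}^n(i))$, regarded as a column when juxtaposed. An $n$-ary $f$ satisfies $\Phi$ if, whenever $[\mathbf{M}_1|\mathbf{M}_2]\prec\Phi$ where $\mathbf{M}_1$ has $n$ columns and $\mathbf{M}_2$ may be empty, then $[f\mathbf{M}_1|\mathbf{M}_2]\prec\Phi$. $\mathcal{T}$ is characterized by a set $\mathcal{F}$ of operations if $\mathcal{T}$ is precisely the set of clusters on $A$ satisfied by every operation in $\mathcal{F}$. Special clusters. The $m$-ary trivial cluster of breadth $p\geq 0$ is $\Omega_m^{(p)}=\{S\in\mathcal{M}(A^m):|S|\le p\}$. The $m$-ary empty cluster is $\emptyset$. The binary equality cluster is the set of all $S\in\mathcal{M}(A^2)$ with $\nu_S((a,b))=0$ whenever $a\ne b$. Operations on clusters. For an $m$-ary cluster $\Phi$: $\Phi^{(p)}=\Phi\cap\Omega_m^{(p)}$ for $p\ge0$; the quotient by $S\in\mathcal{M}(A^m)$ is $\Phi/S=\{S'\in\mathcal{M}(A^m):S\uplus S'\in\Phi\}$ (a cluster). $\mathcal{T}$ is: - locally closed if $\Phi\in\mathcal{T}$ whenever $\Phi^{(p)}\in\mathcal{T}$ for all $p\ge0$; - closed under unions if $\bigcup_{j\in J}\Phi_j\in\mathcal{T}$ whenever $(\Phi_j)_{j\in J}$ is a family of clusters in $\mathcal{T}$ of the same arity $m$; - closed under quotients if $\Phi\in\mathcal{T}$ implies $\Phi/S\in\mathcal{T}$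 for every $S$; - closed under dividends if for every cluster $\Phi$ (of arity $m$), $\Phi\in\mathcal{T}$ whenever for some $p\geq 0$ we have $\Omega_m^{(p)}\subseteq\Phi$ and $\Phi/S\in\mathcal{T}$ for every finite multiset $S$ on $A^m$ with $|S|\ge p$; - closed under formation of conjunctive minors if all conjunctive minors of non-empty families of members of $\mathcal{T}$ are members of $\mathcal{T}$. Conjunctive minors. A minor formation scheme with target $m$ (a positive integer), indeterminate set $V$ (an arbitrary set disjoint from the ordinals) and source family $(n_j)_{j\in J}$ (positive integers) is a non-empty family $H=(h_j)_{j\in J}$ of maps $h_j\colon n_j\to m\cup V$. A Skolem map is any map $\sigma\colon V\to A$; for $\mathbf{a}\in A^m$, $\mathbf{a}+\sigma\colon m\cup V\to A$ equals $\mathbf{a}$ on $m$ and $\sigma$ on $V$, and $(\mathbf{a}+\sigma)h_j$ is the $n_j$-tuple $(\mathbf{a}+\sigma)\circ h_j$. Given clusters $\Phi_j$ on $A$ of arity $n_j$ ($j\in J$), an $m$-ary cluster $\Phi$ is a conjunctive minor of $(\Phi_j)_{j\in J}$ via $H$ if for every $m\times n$ matrix $\mathbf{M}=(\mathbf{a}^1,\dots,\mathbf{a}^n)$ over $A$, $\mathbf{M}\prec\Phi$ holds if and only if there are Skolem maps $\sigma_1,\dots,\sigma_n\colon V\to A$ such that $((\mathbf{a}^1+\sigma_1)h_j,\dots,(\mathbf{a}^n+\sigma_n)h_j)\prec\Phi_j$ for all $j\in J$. It is a conjunctive minor of the family if it is one via some scheme. *)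

theory Defs
  imports Main "HOL-Library.Multiset"
begin

text \<open>
  The ground set \<open>A\<close> is the universe of the type \<open>'a\<close> (non-empty, possibly infinite). An
  \<open>m\<close>-tuple over \<open>A\<close> is a list of length \<open>m\<close>, and a matrix is the list of its columns.
  A cluster carries its arity explicitly, since \<open>{}\<close> and \<open>{{#}}\<close> as sets of multisets of lists
  do not determine it.
\<close>

type_synonym 'a cluster = "nat \<times> 'a list multiset set"

definition tuple_msets :: "nat \<Rightarrow> 'a list multiset set" where
  "tuple_msets m = {S. \<forall>a \<in># S. length a = m}"

definition is_cluster :: "nat \<Rightarrow> 'a list multiset set \<Rightarrow> bool" where
  "is_cluster m \<Phi> \<longleftrightarrow> m \<ge> 1 \<and> \<Phi> \<subseteq> tuple_msets m \<and> (\<forall>S S'. S \<in> \<Phi> \<and> S' \<subseteq># S \<longrightarrow> S' \<in> \<Phi>)"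

definition clusters :: "'a cluster set" where
  "clusters = {(m, \<Phi>). is_cluster m \<Phi>}"

abbreviation mat_in :: "'a list list \<Rightarrow> 'a list multiset set \<Rightarrow> bool" (infix "\<prec>" 50) where
  "M \<prec> \<Phi> \<equiv> mset M \<in> \<Phi>"


subsection \<open>Operations and satisfaction\<close>

text \<open>
  An \<open>n\<close>-ary operation is a pair \<open>(n, f)\<close> with \<open>n \<ge> 1\<close>; only the values of \<open>f\<close> on lists of
  length \<open>n\<close> are ever used.
\<close>

type_synonym 'a operation = "nat \<times> ('a list \<Rightarrow> 'a)"

definition apply_rows :: "nat \<Rightarrow> ('a list \<Rightarrow> 'a) \<Rightarrow> 'a list list \<Rightarrow> 'a list" where
  "apply_rows m f M = map (\<lambda>i. f (map (\<lambda>a. a ! i) M)) [0..<m]"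

definition satisfies :: "'a operation \<Rightarrow> 'a cluster \<Rightarrow> bool" where
  "satisfies = (\<lambda>(n, f) (m, \<Phi>).
     \<forall>M\<^sub>1 M\<^sub>2. length M\<^sub>1 = n \<and> M\<^sub>1 @ M\<^sub>2 \<prec> \<Phi> \<longrightarrow> [apply_rows m f M\<^sub>1] @ M\<^sub>2 \<prec> \<Phi>)"

definition characterized_by :: "'a cluster set \<Rightarrow> 'a operation set \<Rightarrow> bool" where
  "characterized_by \<T> \<F> \<longleftrightarrow> \<T> = {C \<in> clusters. \<forall>f \<in> \<F>. satisfies f C}"


subsection \<open>Special clusters and operations on clusters\<close>

definition trivial_cluster :: "nat \<Rightarrow> nat \<Rightarrow> 'a list multiset set" where
  "trivial_cluster m p = {S \<in> tuple_msets m. size S \<le> p}"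

definition equality_cluster :: "'a list multiset set" where
  "equality_cluster = {S \<in> tuple_msets 2. \<forall>a b. a \<noteq> b \<longrightarrow> count S [a, b] = 0}"

definition quotient_cluster ::
    "nat \<Rightarrow> 'a list multiset set \<Rightarrow> 'a list multiset \<Rightarrow> 'a list multiset set" where
  "quotient_cluster m \<Phi> S = {S' \<in> tuple_msets m. S + S' \<in> \<Phi>}"

definition locally_closed :: "'a cluster set \<Rightarrow> bool" where
  "locally_closed \<T> \<longleftrightarrow>
     (\<forall>m \<Phi>. is_cluster m \<Phi> \<and> (\<forall>p. (m, \<Phi> \<inter> trivial_cluster m p) \<in> \<T>) \<longrightarrow> (m, \<Phi>) \<in> \<T>)"

text \<open>The union of a family is the union of its set of members; the family may be empty.\<close>

definition closed_under_unions :: "'a cluster set \<Rightarrow> bool" where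
  "closed_under_unions \<T> \<longleftrightarrow>
     (\<forall>m X. m \<ge> 1 \<and> (\<forall>\<Phi> \<in> X. (m, \<Phi>) \<in> \<T>) \<longrightarrow> (m, \<Union>X) \<in> \<T>)"

definition closed_under_quotients :: "'a cluster set \<Rightarrow> bool" where
  "closed_under_quotients \<T> \<longleftrightarrow>
     (\<forall>m \<Phi>. (m, \<Phi>) \<in> \<T> \<longrightarrow> (\<forall>S \<in> tuple_msets m. (m, quotient_cluster m \<Phi> S) \<in> \<T>))"

definition closed_under_dividends :: "'a cluster set \<Rightarrow> bool" where
  "closed_under_dividends \<T> \<longleftrightarrow>
     (\<forall>m \<Phi>. is_cluster m \<Phi> \<and>
        (\<exists>p. trivial_cluster m p \<subseteq> \<Phi> \<and>
             (\<forall>S \<in> tuple_msets m. size S \<ge> p \<longrightarrow> (m, quotient_cluster m \<Phi> S) \<in> \<T>))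
      \<longrightarrow> (m, \<Phi>) \<in> \<T>)"


subsection \<open>Conjunctive minors\<close>

text \<open>
  The disjoint union of \<open>m = {0, \<dots>, m - 1}\<close> and the indeterminate set \<open>V\<close> is rendered in the
  sum type \<open>nat + 'v\<close>; a map \<open>h j\<close> from \<open>n j\<close> into it is a list of length \<open>n j\<close>.
\<close>

definition minor_scheme ::
    "nat \<Rightarrow> 'v set \<Rightarrow> 'j set \<Rightarrow> ('j \<Rightarrow> nat) \<Rightarrow> ('j \<Rightarrow> (nat + 'v) list) \<Rightarrow> bool" where
  "minor_scheme m V J n h \<longleftrightarrow> m \<ge> 1 \<and> J \<noteq> {} \<and>
     (\<forall>j \<in> J. n j \<ge> 1 \<and> length (h j) = n j \<and> set (h j) \<subseteq> Inl ` {..<m} \<union> Inr ` V)"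

text \<open>
  \<open>skolem_tuple a \<sigma> h\<close> is the tuple \<open>(a + \<sigma>) h\<close>. Skolem maps are total functions on \<open>'v\<close>, but
  only their values on \<open>V\<close> matter, as \<open>h\<close> involves no other indeterminates.
\<close>

definition skolem_tuple :: "'a list \<Rightarrow> ('v \<Rightarrow> 'a) \<Rightarrow> (nat + 'v) list \<Rightarrow> 'a list" where
  "skolem_tuple a \<sigma> h = map (case_sum (\<lambda>i. a ! i) \<sigma>) h"

definition conj_minor_via ::
    "'v set \<Rightarrow> ('j \<Rightarrow> (nat + 'v) list) \<Rightarrow> 'j set \<Rightarrow> ('j \<Rightarrow> 'a cluster) \<Rightarrow> 'a cluster \<Rightarrow> bool" where
  "conj_minor_via V h J \<Psi> = (\<lambda>(m, \<Phi>).
     minor_scheme m V J (\<lambda>j. fst (\<Psi> j)) h \<and> is_cluster m \<Phi> \<and>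
     (\<forall>M. (\<forall>a \<in> set M. length a = m) \<longrightarrow>
        (M \<prec> \<Phi> \<longleftrightarrow>
         (\<exists>\<sigma>. \<forall>j \<in> J. map (\<lambda>i. skolem_tuple (M ! i) (\<sigma> i) (h j)) [0..<length M] \<prec> snd (\<Psi> j)))))"

text \<open>
  The indeterminate set and the index set of a scheme are arbitrary sets, but HOL cannot quantify
  over types inside a formula. We therefore let them range over all subsets of two types that are
  large enough to realize every conjunctive minor: indeterminates that agree in a chosen system of
  Skolem maps, one for each matrix in the minor, can be identified, and repetitions
  in the family of pairs \<open>(\<Psi> j, h j)\<close> are irrelevant. Lemmas \<open>conj_minor_iff\<close> and
  \<open>closed_under_conj_minors_iff\<close> show that nothing is lost in comparison with any other choice
  of types.
\<close>

type_synonym 'a indet = "'a list list \<Rightarrow> 'a list"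
type_synonym 'a index = "'a cluster \<times> (nat + 'a indet) list"

definition conj_minor :: "'j set \<Rightarrow> ('j \<Rightarrow> 'a cluster) \<Rightarrow> 'a cluster \<Rightarrow> bool" where
  "conj_minor J \<Psi> C \<longleftrightarrow> (\<exists>(V :: 'a indet set) h. conj_minor_via V h J \<Psi> C)"

definition closed_under_conj_minors :: "'a cluster set \<Rightarrow> bool" where
  "closed_under_conj_minors \<T> \<longleftrightarrow>
     (\<forall>(J :: 'a index set) \<Psi> C. J \<noteq> {} \<and> (\<forall>j \<in> J. \<Psi> j \<in> \<T>) \<and> conj_minor J \<Psi> C \<longrightarrow> C \<in> \<T>)"

lemma skolem_tuple_rename:
  "skolem_tuple a \<sigma> (map (map_sum id g) h) = skolem_tuple a (\<lambda>v. \<sigma> (g v)) h"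
  unfolding skolem_tuple_def by (auto split: sum.split)

lemma conj_minor_viaI:
  fixes V :: "'v set" and J :: "'j set" and \<Psi> :: "'j \<Rightarrow> 'a cluster"
  assumes "conj_minor_via V h J \<Psi> C"
  shows "conj_minor J \<Psi> C"
proof -
  obtain m \<Phi> where C: "C = (m, \<Phi>)" by (cases C)
  define good where "good M \<sigma> \<longleftrightarrow>
    (\<forall>j \<in> J. map (\<lambda>i. skolem_tuple (M ! i) (\<sigma> i) (h j)) [0..<length M] \<prec> snd (\<Psi> j))"
    for M and \<sigma> :: "nat \<Rightarrow> 'v \<Rightarrow> 'a"
  have sch: "minor_scheme m V J (\<lambda>j. fst (\<Psi> j)) h" and cl: "is_cluster m \<Phi>"
    and via: "\<And>M. \<forall>a \<in> set M. length a = m \<Longrightarrow> M \<prec> \<Phi> \<longleftrightarrow> (\<exists>\<sigma>. good M \<sigma>)"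
    using assms unfolding conj_minor_via_def C good_def by auto
  define \<tau> where "\<tau> M = (SOME \<sigma>. good M \<sigma>)" for M
  define g :: "'v \<Rightarrow> 'a indet" where "g v = (\<lambda>M. map (\<lambda>i. \<tau> M i v) [0..<length M])" for v
  define h' where "h' j = map (map_sum id g) (h j)" for j
  have "minor_scheme m (g ` V) J (\<lambda>j. fst (\<Psi> j)) h'"
    using sch unfolding minor_scheme_def h'_def by fastforce
  moreover have "M \<prec> \<Phi> \<longleftrightarrow>
      (\<exists>\<sigma>. \<forall>j \<in> J. map (\<lambda>i. skolem_tuple (M ! i) (\<sigma> i) (h' j)) [0..<length M] \<prec> snd (\<Psi> j))"
    (is "_ \<longleftrightarrow> (\<exists>\<sigma>. ?R \<sigma>)") if M: "\<forall>a \<in> set M. length a = m" for M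
  proof
    assume "M \<prec> \<Phi>"
    then have "good M (\<tau> M)"
      using via[OF M] unfolding \<tau>_def by (metis someI_ex)
    moreover have "map (\<lambda>i. skolem_tuple (M ! i) (\<lambda>w. w M ! i) (h' j)) [0..<length M]
        = map (\<lambda>i. skolem_tuple (M ! i) (\<tau> M i) (h j)) [0..<length M]" for j
      unfolding h'_def skolem_tuple_rename by (simp add: g_def)
    ultimately have "?R (\<lambda>i w. w M ! i)"
      unfolding good_def by (simp only:)
    then show "\<exists>\<sigma>. ?R \<sigma>" by - (rule exI[where x = "\<lambda>i w. w M ! i"])
  next
    assume "\<exists>\<sigma>. ?R \<sigma>"
    then obtain \<sigma> where "?R \<sigma>" ..
    then have "good M (\<lambda>i v. \<sigma> i (g v))"
      unfolding good_def h'_def skolem_tuple_rename .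
    then show "M \<prec> \<Phi>" using via[OF M] by auto
  qed
  ultimately have "conj_minor_via (g ` V) h' J \<Psi> C"
    using cl unfolding conj_minor_via_def C by simp
  then show ?thesis unfolding conj_minor_def by blast
qed

lemma conj_minor_iff:
  fixes J :: "'j set" and \<Psi> :: "'j \<Rightarrow> 'a cluster"
  assumes "inj (emb :: 'a indet \<Rightarrow> 'v)"
  shows "conj_minor J \<Psi> C \<longleftrightarrow> (\<exists>(V :: 'v set) h. conj_minor_via V h J \<Psi> C)"
proof
  assume "conj_minor J \<Psi> C"
  then obtain V :: "'a indet set" and h where via: "conj_minor_via V h J \<Psi> C"
    unfolding conj_minor_def by blast
  obtain m \<Phi> where C: "C = (m, \<Phi>)" by (cases C)
  define h' where "h' j = map (map_sum id emb) (h j)" for j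
  have "minor_scheme m (emb ` V) J (\<lambda>j. fst (\<Psi> j)) h'"
    using via unfolding conj_minor_via_def C minor_scheme_def h'_def by fastforce
  moreover have "(\<exists>\<sigma>. \<forall>j \<in> J. map (\<lambda>i. skolem_tuple (M ! i) (\<sigma> i) (h' j)) [0..<length M] \<prec> snd (\<Psi> j))
     \<longleftrightarrow> (\<exists>\<sigma>. \<forall>j \<in> J. map (\<lambda>i. skolem_tuple (M ! i) (\<sigma> i) (h j)) [0..<length M] \<prec> snd (\<Psi> j))"
    (is "(\<exists>\<sigma>. ?R' \<sigma>) \<longleftrightarrow> (\<exists>\<sigma>. ?R \<sigma>)") for M :: "'a list list"
  proof
    assume "\<exists>\<sigma>. ?R' \<sigma>"
    then obtain \<sigma> where "?R' \<sigma>" ..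
    then have "?R (\<lambda>i v. \<sigma> i (emb v))" unfolding h'_def skolem_tuple_rename .
    then show "\<exists>\<sigma>. ?R \<sigma>" by - (rule exI[where x = "\<lambda>i v. \<sigma> i (emb v)"])
  next
    assume "\<exists>\<sigma>. ?R \<sigma>"
    then obtain \<sigma> where "?R \<sigma>" ..
    then have "?R' (\<lambda>i w. \<sigma> i (inv emb w))"
      unfolding h'_def skolem_tuple_rename using assms by simp
    then show "\<exists>\<sigma>. ?R' \<sigma>" by - (rule exI[where x = "\<lambda>i w. \<sigma> i (inv emb w)"])
  qed
  ultimately have "conj_minor_via (emb ` V) h' J \<Psi> C"
    using via unfolding conj_minor_via_def C by simp
  then show "\<exists>(V :: 'v set) h. conj_minor_via V h J \<Psi> C" by blast
qed (elim exE, rule conj_minor_viaI)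

lemma conj_minor_in_closed:
  fixes V :: "'v set" and J :: "'j set" and \<Psi> :: "'j \<Rightarrow> 'a cluster"
  assumes closed: "closed_under_conj_minors \<T>"
    and mem: "\<forall>j \<in> J. \<Psi> j \<in> \<T>" and minor: "conj_minor_via V h J \<Psi> C"
  shows "C \<in> \<T>"
proof -
  obtain V' :: "'a indet set" and h' where via: "conj_minor_via V' h' J \<Psi> C"
    using conj_minor_viaI[OF minor] unfolding conj_minor_def by blast
  define K where "K = (\<lambda>j. (\<Psi> j, h' j)) ` J"
  obtain m \<Phi> where C: "C = (m, \<Phi>)" by (cases C)
  have "conj_minor_via V' snd K fst C"
    using via unfolding conj_minor_via_def minor_scheme_def C K_def by simp
  moreover have "K \<noteq> {}"
    using via unfolding conj_minor_via_def minor_scheme_def C K_def by simp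
  moreover have "\<forall>k \<in> K. fst k \<in> \<T>" using mem unfolding K_def by auto
  ultimately show ?thesis
    using closed unfolding closed_under_conj_minors_def conj_minor_def by blast
qed

lemma closed_under_conj_minors_iff:
  fixes \<T> :: "'a cluster set"
  assumes v: "inj (emb\<^sub>v :: 'a indet \<Rightarrow> 'v)" and j: "inj (emb\<^sub>j :: 'a index \<Rightarrow> 'j)"
  shows "closed_under_conj_minors \<T> \<longleftrightarrow>
    (\<forall>(V :: 'v set) h (J :: 'j set) \<Psi> C.
       (\<forall>j \<in> J. \<Psi> j \<in> \<T>) \<and> conj_minor_via V h J \<Psi> C \<longrightarrow> C \<in> \<T>)"
proof
  assume R: "\<forall>(V :: 'v set) h (J :: 'j set) \<Psi> C.
       (\<forall>j \<in> J. \<Psi> j \<in> \<T>) \<and> conj_minor_via V h J \<Psi> C \<longrightarrow> C \<in> \<T>"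
  show "closed_under_conj_minors \<T>"
    unfolding closed_under_conj_minors_def
  proof (intro allI impI, elim conjE)
    fix J :: "'a index set" and \<Psi> C
    assume mem: "\<forall>j \<in> J. \<Psi> j \<in> \<T>" and "conj_minor J \<Psi> C"
    then obtain V :: "'v set" and h where via: "conj_minor_via V h J \<Psi> C"
      using conj_minor_iff[OF v] by blast
    obtain m \<Phi> where C: "C = (m, \<Phi>)" by (cases C)
    have "conj_minor_via V (\<lambda>i. h (inv emb\<^sub>j i)) (emb\<^sub>j ` J) (\<lambda>i. \<Psi> (inv emb\<^sub>j i)) C"
      using via j unfolding conj_minor_via_def minor_scheme_def C by simp
    moreover have "\<forall>i \<in> emb\<^sub>j ` J. \<Psi> (inv emb\<^sub>j i) \<in> \<T>" using mem j by simp
    ultimately show "C \<in> \<T>" by (intro R[rule_format] conjI) auto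
  qed
qed (intro allI impI, elim conjE, rule conj_minor_in_closed)

end

theory Submission
  imports Defs
begin

text \<open>
  That closed sets are characterized is seen as follows. Let \<open>\<Phi>\<close> be a cluster satisfied by all operations
  that satisfy \<open>\<T>\<close>; by local closure its breadth may be assumed bounded, and we induct on the
  bound. The quotients of \<open>\<Phi>\<close> by non-empty multisets are then in \<open>\<T>\<close>, so closure under dividends
  (with \<open>p = 1\<close>) puts \<open>\<Phi>' = \<Phi> \<union> \<Omega>\<^sup>(\<^sup>1\<^sup>)\<close> into \<open>\<T>\<close>. For a non-empty matrix \<open>M\<close> in \<open>\<Phi>\<close> with \<open>n\<close> columns,
  a conjunctive minor whose indeterminates are the \<open>n\<close>-tuples over \<open>A\<close> yields a
  member \<open>\<Theta>\<close> of \<open>\<T>\<close> that contains \<open>M\<close> and whose single columns are all of the form \<open>f M\<close> with \<open>f\<close>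
  satisfying \<open>\<T>\<close>. Hence \<open>M \<in> \<Theta> \<inter> \<Phi>' \<subseteq> \<Phi>\<close>, and \<open>\<Phi>\<close> is a union of such members of \<open>\<T>\<close>.
\<close>

section \<open>Operations satisfying a cluster\<close>

lemma length_apply_rows [simp]: "length (apply_rows m f M) = m"
  by (simp add: apply_rows_def)

text \<open>Only the multiset of columns of \<open>M\<^sub>2\<close> matters, and every finite
  multiset has an enumeration, so the remaining columns can be carried as a multiset
  \<open>S\<close>.\<close>

lemma satisfies_iff:
  "satisfies (n, f) (m, \<Phi>) \<longleftrightarrow>
    (\<forall>M S. length M = n \<and> mset M + S \<in> \<Phi> \<longrightarrow> add_mset (apply_rows m f M) S \<in> \<Phi>)"
  unfolding satisfies_def prod.case by (metis append_Cons append_Nil ex_mset mset.simps(2) mset_append)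

lemma satisfiesD:
  assumes "satisfies (n, f) (m, \<Phi>)" "mset M + S \<in> \<Phi>" "length M = n"
  shows "add_mset (apply_rows m f M) S \<in> \<Phi>"
  using assms by (auto simp: satisfies_iff)

text \<open>Replacing \<open>n \<ge> 1\<close> columns by a single one cannot increase the number of
  columns.\<close>

lemma satisfies_trivial_cluster:
  assumes "n \<ge> 1"
  shows "satisfies (n, f) (m, trivial_cluster m p)"
  using assms by (auto simp: satisfies_iff trivial_cluster_def tuple_msets_def)

text \<open>If both entries of each column agree, then the two rows of the matrix are equal, and
  \<open>f\<close> takes the same value on them.\<close>

lemma satisfies_equality_cluster: "satisfies (n, f) (2, equality_cluster)"
  unfolding satisfies_iff
proof (intro allI impI, elim conjE)
  fix M and S :: "'a list multiset"
  assume "mset M + S \<in> equality_cluster"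
  then have len: "\<forall>c \<in> set M. length c = 2" "\<forall>c \<in># S. length c = 2"
    and eq: "\<forall>a b. a \<noteq> b \<longrightarrow> [a, b] \<notin> set M \<and> count S [a, b] = 0"
    by (auto simp: equality_cluster_def tuple_msets_def count_eq_zero_iff)
  have "c ! 0 = c ! 1" if "c \<in> set M" for c
  proof -
    have "c = [c ! 0, c ! 1]"
      using len(1) that by (intro nth_equalityI) (auto simp: less_2_cases_iff)
    with eq that show ?thesis by metis
  qed
  then have "map (\<lambda>c. c ! 0) M = map (\<lambda>c. c ! 1) M" by (intro map_cong refl)
  then have "apply_rows 2 f M ! 0 = apply_rows 2 f M ! 1"
    by (simp add: apply_rows_def cong: map_cong)
  then have "apply_rows 2 f M \<noteq> [a, b]" if "a \<noteq> b" for a b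
    using that by auto
  with eq len(2) show "add_mset (apply_rows 2 f M) S \<in> equality_cluster"
    by (auto simp: equality_cluster_def tuple_msets_def)
qed

lemma satisfies_Int:
  assumes "satisfies (n, f) (m, \<Phi>)" "satisfies (n, f) (m, \<Psi>)"
  shows "satisfies (n, f) (m, \<Phi> \<inter> \<Psi>)"
  using assms by (auto simp: satisfies_iff)

lemma satisfies_Union:
  assumes "\<And>\<Phi>. \<Phi> \<in> X \<Longrightarrow> satisfies (n, f) (m, \<Phi>)"
  shows "satisfies (n, f) (m, \<Union>X)"
  using assms by (auto simp: satisfies_iff)

text \<open>The divisor \<open>S\<close> simply joins the columns on which \<open>f\<close> does not
  act.\<close>

lemma satisfies_quotient_cluster:
  assumes "satisfies (n, f) (m, \<Phi>)"
  shows "satisfies (n, f) (m, quotient_cluster m \<Phi> S)"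
  unfolding satisfies_iff
proof (intro allI impI, elim conjE)
  fix M T
  assume "length M = n" "mset M + T \<in> quotient_cluster m \<Phi> S"
  then have "mset M + (S + T) \<in> \<Phi>" "T \<in> tuple_msets m"
    by (auto simp: quotient_cluster_def tuple_msets_def ac_simps)
  with satisfiesD[OF assms] \<open>length M = n\<close>
  show "add_mset (apply_rows m f M) T \<in> quotient_cluster m \<Phi> S"
    by (auto simp: quotient_cluster_def tuple_msets_def)
qed

text \<open>The remaining columns \<open>S\<close> serve as the divisor. If there are at least
  \<open>p\<close> of them, \<open>f\<close> acts on a matrix in the quotient by \<open>S\<close>
  with nothing remaining; otherwise the result has at most \<open>p\<close> columns and lies in the
  trivial cluster.\<close>

lemma satisfies_dividend:
  assumes \<Phi>: "is_cluster m \<Phi>" and triv: "trivial_cluster m p \<subseteq> \<Phi>"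
    and quot: "\<And>S. S \<in> tuple_msets m \<Longrightarrow> size S \<ge> p \<Longrightarrow> satisfies (n, f) (m, quotient_cluster m \<Phi> S)"
  shows "satisfies (n, f) (m, \<Phi>)"
  unfolding satisfies_iff
proof (intro allI impI, elim conjE)
  fix M S
  assume n: "length M = n" and M: "mset M + S \<in> \<Phi>"
  with \<Phi> have MS: "mset M + S \<in> tuple_msets m" by (auto simp: is_cluster_def)
  then have S: "S \<in> tuple_msets m" by (auto simp: tuple_msets_def)
  show "add_mset (apply_rows m f M) S \<in> \<Phi>"
  proof (cases "size S \<ge> p")
    case True
    have "mset M + {#} \<in> quotient_cluster m \<Phi> S"
      using M MS by (auto simp: quotient_cluster_def tuple_msets_def ac_simps)
    from satisfiesD[OF quot[OF S True] this n] show ?thesis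
      by (simp add: quotient_cluster_def)
  next
    case False
    then have "add_mset (apply_rows m f M) S \<in> trivial_cluster m p"
      using S by (auto simp: trivial_cluster_def tuple_msets_def)
    with triv show ?thesis by blast
  qed
qed

text \<open>Operations commute with substitution along the maps \<open>h j\<close>: applying
  \<open>f\<close> pointwise to the Skolem maps of the columns of \<open>M\<^sub>1\<close> gives a
  Skolem map for the new column, while the columns of \<open>M\<^sub>2\<close> keep theirs.\<close>

lemma satisfies_conj_minor_via:
  assumes minor: "conj_minor_via V h J \<Psi> (m, \<Phi>)"
    and sat: "\<And>j. j \<in> J \<Longrightarrow> satisfies (n, f) (\<Psi> j)"
  shows "satisfies (n, f) (m, \<Phi>)"
  unfolding satisfies_def prod.case
proof (intro allI impI, elim conjE)
  fix M\<^sub>1 M\<^sub>2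
  let ?M = "M\<^sub>1 @ M\<^sub>2" and ?M' = "[apply_rows m f M\<^sub>1] @ M\<^sub>2"
  assume n: "length M\<^sub>1 = n" and M: "?M \<prec> \<Phi>"
  have sch: "minor_scheme m V J (\<lambda>j. fst (\<Psi> j)) h"
    and via: "\<And>M. \<forall>a \<in> set M. length a = m \<Longrightarrow> M \<prec> \<Phi> \<longleftrightarrow>
      (\<exists>\<sigma>. \<forall>j \<in> J. map (\<lambda>i. skolem_tuple (M ! i) (\<sigma> i) (h j)) [0..<length M] \<prec> snd (\<Psi> j))"
    and "\<Phi> \<subseteq> tuple_msets m"
    using minor by (auto simp: conj_minor_via_def is_cluster_def)
  with M have len: "\<forall>a \<in> set ?M. length a = m"
    unfolding tuple_msets_def by fastforce
  obtain \<sigma> where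
    \<sigma>: "\<And>j. j \<in> J \<Longrightarrow> map (\<lambda>i. skolem_tuple (?M ! i) (\<sigma> i) (h j)) [0..<length ?M] \<prec> snd (\<Psi> j)"
    using via[OF len] M by blast
  \<comment> \<open>Column 0 of \<open>?M'\<close> is the new one; column \<open>Suc k\<close> of
    \<open>?M'\<close> is column \<open>n + k\<close> of \<open>?M\<close>, hence the shift.\<close>
  define \<sigma>' where "\<sigma>' i = (case i of 0 \<Rightarrow> \<lambda>v. f (map (\<lambda>k. \<sigma> k v) [0..<n]) | Suc k \<Rightarrow> \<sigma> (n + k))" for i
  have "map (\<lambda>i. skolem_tuple (?M' ! i) (\<sigma>' i) (h j)) [0..<length ?M'] \<prec> snd (\<Psi> j)"
    if j: "j \<in> J" for j
  proof -
    let ?N\<^sub>1 = "map (\<lambda>i. skolem_tuple (M\<^sub>1 ! i) (\<sigma> i) (h j)) [0..<n]"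
    let ?N\<^sub>2 = "map (\<lambda>i. skolem_tuple (M\<^sub>2 ! i) (\<sigma> (n + i)) (h j)) [0..<length M\<^sub>2]"
    obtain r \<Gamma> where \<Psi>: "\<Psi> j = (r, \<Gamma>)" by (cases "\<Psi> j")
    have r: "length (h j) = r" and h: "set (h j) \<subseteq> Inl ` {..<m} \<union> Inr ` V"
      using sch j \<Psi> by (auto simp: minor_scheme_def)
    have "map (\<lambda>i. skolem_tuple (?M ! i) (\<sigma> i) (h j)) [0..<length ?M] = ?N\<^sub>1 @ ?N\<^sub>2"
      using n by (intro nth_equalityI) (auto simp: nth_append)
    with \<sigma>[OF j] have "mset ?N\<^sub>1 + mset ?N\<^sub>2 \<in> \<Gamma>"
      by (simp only: \<Psi> snd_conv mset_append)
    from satisfiesD[OF sat[OF j, unfolded \<Psi>] this]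
    have *: "[apply_rows r f ?N\<^sub>1] @ ?N\<^sub>2 \<prec> \<Gamma>" by simp
    \<comment> \<open>A position of \<open>h j\<close> points either at a row of
      \<open>M\<^sub>1\<close> or at an indeterminate; in both cases \<open>f\<close> is evaluated
      on the list of the \<open>n\<close> values found there.\<close>
    have "apply_rows r f ?N\<^sub>1 = skolem_tuple (apply_rows m f M\<^sub>1) (\<sigma>' 0) (h j)"
    proof (intro nth_equalityI)
      fix i assume "i < length (apply_rows r f ?N\<^sub>1)"
      then have i: "i < r" by simp
      then have "h j ! i \<in> Inl ` {..<m} \<union> Inr ` V" using h r by (metis nth_mem subsetD)
      then show "apply_rows r f ?N\<^sub>1 ! i = skolem_tuple (apply_rows m f M\<^sub>1) (\<sigma>' 0) (h j) ! i"
      proof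
        assume "h j ! i \<in> Inl ` {..<m}"
        then obtain k where k: "h j ! i = Inl k" "k < m" by auto
        have "map (\<lambda>l. M\<^sub>1 ! l ! k) [0..<n] = map (\<lambda>a. a ! k) M\<^sub>1"
          using n by (intro nth_equalityI) auto
        with i r k show ?thesis by (simp add: apply_rows_def skolem_tuple_def comp_def)
      qed (use i r in \<open>auto simp: apply_rows_def skolem_tuple_def \<sigma>'_def comp_def\<close>)
    qed (simp add: skolem_tuple_def r)
    with * have "[skolem_tuple (apply_rows m f M\<^sub>1) (\<sigma>' 0) (h j)] @ ?N\<^sub>2 \<prec> \<Gamma>" by simp
    also have "[skolem_tuple (apply_rows m f M\<^sub>1) (\<sigma>' 0) (h j)] @ ?N\<^sub>2 =
        map (\<lambda>i. skolem_tuple (?M' ! i) (\<sigma>' i) (h j)) [0..<length ?M']"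
      by (intro nth_equalityI) (auto simp: nth_Cons \<sigma>'_def simp del: upt_Suc split: nat.split)
    finally show ?thesis by (simp add: \<Psi>)
  qed
  then have "\<exists>\<sigma>. \<forall>j \<in> J. map (\<lambda>i. skolem_tuple (?M' ! i) (\<sigma> i) (h j)) [0..<length ?M'] \<prec> snd (\<Psi> j)"
    by blast
  moreover have "\<forall>a \<in> set ?M'. length a = m" using len by simp
  ultimately show "?M' \<prec> \<Phi>" using via by blast
qed


section \<open>Existence of conjunctive minors\<close>

lemma is_cluster_quotient_cluster:
  assumes "is_cluster m \<Phi>"
  shows "is_cluster m (quotient_cluster m \<Phi> S)"
  unfolding is_cluster_def
proof (intro conjI allI impI)
  show "1 \<le> m" using assms by (simp add: is_cluster_def)
  show "quotient_cluster m \<Phi> S \<subseteq> tuple_msets m" by (auto simp: quotient_cluster_def)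
  fix T T' assume T: "T \<in> quotient_cluster m \<Phi> S \<and> T' \<subseteq># T"
  then have "S + T \<in> \<Phi>" "S + T' \<subseteq># S + T" by (auto simp: quotient_cluster_def)
  then have "S + T' \<in> \<Phi>" using assms unfolding is_cluster_def by blast
  moreover have "T' \<in> tuple_msets m"
    using T unfolding quotient_cluster_def tuple_msets_def by (blast dest: mset_subset_eqD)
  ultimately show "T' \<in> quotient_cluster m \<Phi> S" by (simp add: quotient_cluster_def)
qed

lemma is_cluster_trivial_cluster: "m \<ge> 1 \<Longrightarrow> is_cluster m (trivial_cluster m p)"
  unfolding is_cluster_def trivial_cluster_def tuple_msets_def
  by (auto dest: mset_subset_eqD size_mset_mono)

lemma trivial_cluster_0: "trivial_cluster m 0 = {{#}}"
  by (auto simp: trivial_cluster_def tuple_msets_def)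

lemma is_cluster_Int: "is_cluster m \<Phi> \<Longrightarrow> is_cluster m \<Psi> \<Longrightarrow> is_cluster m (\<Phi> \<inter> \<Psi>)"
  unfolding is_cluster_def by blast

lemma is_cluster_Un: "is_cluster m \<Phi> \<Longrightarrow> is_cluster m \<Psi> \<Longrightarrow> is_cluster m (\<Phi> \<union> \<Psi>)"
  unfolding is_cluster_def by blast

lemma is_cluster_Union: "m \<ge> 1 \<Longrightarrow> (\<And>\<Phi>. \<Phi> \<in> X \<Longrightarrow> is_cluster m \<Phi>) \<Longrightarrow> is_cluster m (\<Union>X)"
  unfolding is_cluster_def by blast

lemma is_cluster_equality_cluster: "is_cluster 2 equality_cluster"
  unfolding is_cluster_def equality_cluster_def tuple_msets_def
  by (auto dest: mset_subset_eqD simp: count_eq_zero_iff)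

text \<open>Each occurrence of a column is paired in \<open>P\<close> with its own Skolem map, so
  equal columns may use different maps, without numbering the columns.\<close>

definition minor_cluster ::
    "nat \<Rightarrow> ('j \<Rightarrow> (nat + 'v) list) \<Rightarrow> 'j set \<Rightarrow> ('j \<Rightarrow> 'a cluster) \<Rightarrow> 'a list multiset set" where
  "minor_cluster m h J \<Psi> = {S \<in> tuple_msets m. \<exists>P. image_mset fst P = S \<and>
     (\<forall>j \<in> J. image_mset (\<lambda>(a, \<sigma>). skolem_tuple a \<sigma> (h j)) P \<in> snd (\<Psi> j))}"

text \<open>An enumeration of the image is pulled back one preimage at a time. This aligns a
  multiset of witnessing pairs with a given list of columns.\<close>

lemma image_mset_eq_mset_lift:
  assumes "image_mset f P = mset xs"
  shows "\<exists>ys. mset ys = P \<and> map f ys = xs"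
  using assms
proof (induction xs arbitrary: P)
  case (Cons x xs)
  then have "image_mset f P = add_mset x (mset xs)" by simp
  then obtain Q y where "P = add_mset y Q" "f y = x" "image_mset f Q = mset xs"
    by (metis msed_map_invR)
  with Cons.IH[of Q] show ?case by (metis list.simps(9) mset.simps(2))
qed auto

text \<open>Downward closure holds because the pairs over the retained columns still witness
  membership. The defining equivalence passes between multisets of pairs and Skolem maps indexed by
  column positions.\<close>

lemma conj_minor_via_minor_cluster:
  assumes sch: "minor_scheme m V J (\<lambda>j. fst (\<Psi> j)) h"
    and cl: "\<And>j. j \<in> J \<Longrightarrow> \<Psi> j \<in> clusters"
  shows "conj_minor_via V h J \<Psi> (m, minor_cluster m h J \<Psi>)"
proof -
  have "is_cluster m (minor_cluster m h J \<Psi>)"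
    unfolding is_cluster_def
  proof (intro conjI allI impI)
    show "1 \<le> m" using sch by (simp add: minor_scheme_def)
    show "minor_cluster m h J \<Psi> \<subseteq> tuple_msets m" by (auto simp: minor_cluster_def)
    fix S S' assume "S \<in> minor_cluster m h J \<Psi> \<and> S' \<subseteq># S"
    then obtain P D where S: "S \<in> tuple_msets m" "S = S' + D" "image_mset fst P = S"
      and P: "\<And>j. j \<in> J \<Longrightarrow> image_mset (\<lambda>(a, \<sigma>). skolem_tuple a \<sigma> (h j)) P \<in> snd (\<Psi> j)"
      unfolding minor_cluster_def mset_subset_eq_exists_conv by blast
    then obtain P' Q where P': "P = P' + Q" "S' = image_mset fst P'"
      by (metis image_mset_eq_plusD)
    have "image_mset (\<lambda>(a, \<sigma>). skolem_tuple a \<sigma> (h j)) P' \<in> snd (\<Psi> j)" if "j \<in> J" for j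
    proof -
      have "is_cluster (fst (\<Psi> j)) (snd (\<Psi> j))"
        using cl[OF that] by (simp add: clusters_def case_prod_beta)
      moreover have "image_mset (\<lambda>(a, \<sigma>). skolem_tuple a \<sigma> (h j)) P' \<subseteq>#
          image_mset (\<lambda>(a, \<sigma>). skolem_tuple a \<sigma> (h j)) P"
        by (simp add: P'(1))
      ultimately show ?thesis using P[OF that] unfolding is_cluster_def by blast
    qed
    with S P' show "S' \<in> minor_cluster m h J \<Psi>"
      by (auto simp: minor_cluster_def tuple_msets_def)
  qed
  moreover have "M \<prec> minor_cluster m h J \<Psi> \<longleftrightarrow>
      (\<exists>\<sigma>. \<forall>j \<in> J. map (\<lambda>i. skolem_tuple (M ! i) (\<sigma> i) (h j)) [0..<length M] \<prec> snd (\<Psi> j))"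
    if M: "\<forall>a \<in> set M. length a = m" for M
  proof
    assume "M \<prec> minor_cluster m h J \<Psi>"
    then obtain P where P: "image_mset fst P = mset M"
      "\<And>j. j \<in> J \<Longrightarrow> image_mset (\<lambda>(a, \<sigma>). skolem_tuple a \<sigma> (h j)) P \<in> snd (\<Psi> j)"
      unfolding minor_cluster_def by blast
    obtain Q where Q: "mset Q = P" "map fst Q = M"
      using image_mset_eq_mset_lift[OF P(1)] by blast
    have "map (\<lambda>i. skolem_tuple (M ! i) (snd (Q ! i)) (h j)) [0..<length M] =
        map (\<lambda>(a, \<sigma>). skolem_tuple a \<sigma> (h j)) Q" for j
      using Q(2) by (intro nth_equalityI) (auto simp: case_prod_beta)
    with P(2) Q(1)
    show "\<exists>\<sigma>. \<forall>j \<in> J. map (\<lambda>i. skolem_tuple (M ! i) (\<sigma> i) (h j)) [0..<length M] \<prec> snd (\<Psi> j)"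
      by (intro exI[of _ "\<lambda>i. snd (Q ! i)"]) (auto simp flip: mset_map)
  next
    assume "\<exists>\<sigma>. \<forall>j \<in> J. map (\<lambda>i. skolem_tuple (M ! i) (\<sigma> i) (h j)) [0..<length M] \<prec> snd (\<Psi> j)"
    then obtain \<sigma> where
      \<sigma>: "\<And>j. j \<in> J \<Longrightarrow> map (\<lambda>i. skolem_tuple (M ! i) (\<sigma> i) (h j)) [0..<length M] \<prec> snd (\<Psi> j)"
      by blast
    let ?Q = "map (\<lambda>i. (M ! i, \<sigma> i)) [0..<length M]"
    have "image_mset fst (mset ?Q) = mset M"
      by (simp only: flip: mset_map) (simp add: comp_def map_nth)
    moreover have "image_mset (\<lambda>(a, \<sigma>). skolem_tuple a \<sigma> (h j)) (mset ?Q) \<in> snd (\<Psi> j)"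
      if "j \<in> J" for j
      using \<sigma>[OF that] by (simp only: flip: mset_map) (simp add: comp_def)
    ultimately show "M \<prec> minor_cluster m h J \<Psi>"
      using M unfolding minor_cluster_def tuple_msets_def by auto
  qed
  ultimately show ?thesis
    using sch unfolding conj_minor_via_def by simp
qed


section \<open>Closed sets of clusters\<close>

text \<open>The scheme has no indeterminates and its maps are the identity on \<open>m\<close>, so
  both sources are tested on the matrix itself.\<close>

lemma closed_under_conj_minors_Int:
  assumes closed: "closed_under_conj_minors \<T>" and cl: "\<T> \<subseteq> clusters"
    and mem: "(m, \<Phi>) \<in> \<T>" "(m, \<Psi>) \<in> \<T>"
  shows "(m, \<Phi> \<inter> \<Psi>) \<in> \<T>"
proof -
  have m: "is_cluster m \<Phi>" "is_cluster m \<Psi>" using mem cl by (auto simp: clusters_def)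
  have "map (\<lambda>i. skolem_tuple (M ! i) (\<sigma> i) (map Inl [0..<m])) [0..<length M] = M"
    if "\<forall>a \<in> set M. length a = m" for M and \<sigma> :: "nat \<Rightarrow> nat \<Rightarrow> 'a"
    using that by (auto intro!: nth_equalityI simp: skolem_tuple_def)
  moreover have "minor_scheme m ({} :: nat set) {\<Phi>, \<Psi>} (\<lambda>_. m) (\<lambda>_. map Inl [0..<m])"
    using m by (auto simp: minor_scheme_def is_cluster_def)
  ultimately have "conj_minor_via ({} :: nat set) (\<lambda>_. map Inl [0..<m]) {\<Phi>, \<Psi>} (Pair m) (m, \<Phi> \<inter> \<Psi>)"
    using is_cluster_Int[OF m] by (simp add: conj_minor_via_def del: mset_map)
  from conj_minor_in_closed[OF closed _ this] mem show ?thesis by simp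
qed

text \<open>Picking coordinate 0 turns every column into a 1-tuple and preserves the number of
  columns, which is all that a trivial cluster sees.\<close>

lemma closed_under_conj_minors_trivial_cluster:
  assumes closed: "closed_under_conj_minors \<T>"
    and mem: "(1, trivial_cluster 1 p) \<in> \<T>" and m: "m \<ge> 1"
  shows "(m, trivial_cluster m p) \<in> \<T>"
proof -
  have "conj_minor_via ({} :: nat set) (\<lambda>_. [Inl 0]) {()} (\<lambda>_. (1, trivial_cluster 1 p))
      (m, trivial_cluster m p)"
    using is_cluster_trivial_cluster[OF m] m
    by (auto simp: conj_minor_via_def minor_scheme_def trivial_cluster_def tuple_msets_def
        skolem_tuple_def)
  from conj_minor_in_closed[OF closed _ this] mem show ?thesis by simp
qed

text \<open>Any operations of positive arity that characterize \<open>\<T>\<close> belong to this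
  set, which makes it the natural candidate.\<close>

definition polymorphisms :: "'a cluster set \<Rightarrow> 'a operation set" where
  "polymorphisms \<T> = {(n, f). n \<ge> 1 \<and> (\<forall>C \<in> \<T>. satisfies (n, f) C)}"

text \<open>
  An indeterminate is a row \<open>x\<close> of length \<open>n\<close>, so that a Skolem map is an \<open>n\<close>-ary operation.
  The matrix \<open>M\<close> itself is witnessed by the projections, and its rows are tied to
  the corresponding indeterminates by equality clusters.
\<close>

lemma ex_member_singletons_polymorphism_images:
  fixes \<T> :: "'a cluster set"
  assumes cl: "\<T> \<subseteq> clusters" and eq: "(2, equality_cluster) \<in> \<T>"
    and minors: "closed_under_conj_minors \<T>" and quot: "closed_under_quotients \<T>"
    and m: "m \<ge> 1" and n: "length M \<ge> 1" and M: "mset M \<in> tuple_msets m"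
  obtains \<Theta> where "(m, \<Theta>) \<in> \<T>" "M \<prec> \<Theta>"
    "\<And>b. {#b#} \<in> \<Theta> \<Longrightarrow> \<exists>f. (length M, f) \<in> polymorphisms \<T> \<and> b = apply_rows m f M"
proof -
  define n where "n = length M"
  \<comment> \<open>The matrix with rows \<open>h\<close>. All lists serve as indeterminates; on
    short ones \<open>x ! k\<close> is unspecified, but \<open>proj\<close> and the witnessing
    Skolem maps \<open>\<lambda>x. x ! k\<close> agree there.\<close>
  define proj :: "'a list list \<Rightarrow> 'a list list" where
    "proj h = map (\<lambda>k. map (\<lambda>x. x ! k) h) [0..<n]" for h
  define row where "row i = map (\<lambda>a. a ! i) M" for i
  \<comment> \<open>The first kind of constraint ranges over all matrices in all members of
    \<open>\<T>\<close>: a Skolem map must send the rows of each such matrix to a single column in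
    the same cluster.\<close>
  define J :: "('a cluster \<times> (nat + 'a list) list) set" where
    "J = {(C, map Inr h) | C h. C \<in> \<T> \<and> length h = fst C \<and> proj h \<prec> snd C} \<union>
         (\<lambda>i. ((2, equality_cluster), [Inl i, Inr (row i)])) ` {..<m}"
  have J\<T>: "\<And>j. j \<in> J \<Longrightarrow> fst j \<in> \<T>" using eq by (auto simp: J_def)
  have pos: "1 \<le> fst C" if "C \<in> \<T>" for C
    using subsetD[OF cl that] by (auto simp: clusters_def is_cluster_def)
  have "minor_scheme m UNIV J (\<lambda>j. fst (fst j)) snd"
    unfolding minor_scheme_def
  proof (intro conjI ballI)
    show "J \<noteq> {}" using m by (auto simp: J_def lessThan_empty_iff)
    fix j assume j: "j \<in> J"
    show "1 \<le> fst (fst j)" by (rule pos[OF J\<T>[OF j]])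
    show "length (snd j) = fst (fst j)" "set (snd j) \<subseteq> Inl ` {..<m} \<union> range Inr"
      using j by (auto simp: J_def)
  qed (fact m)
  from conj_minor_via_minor_cluster[OF this] J\<T> cl
  have "conj_minor_via UNIV snd J fst (m, minor_cluster m snd J fst)" by blast
  with minors J\<T> have mem: "(m, minor_cluster m snd J fst) \<in> \<T>"
    by (blast intro: conj_minor_in_closed)
  have "M \<prec> minor_cluster m snd J fst"
  proof -
    let ?Q = "map (\<lambda>k. (M ! k, \<lambda>x. x ! k)) [0..<n]"
    have "image_mset fst (mset ?Q) = mset M"
      by (simp only: flip: mset_map) (simp add: comp_def n_def map_nth)
    moreover have "image_mset (\<lambda>(a, \<sigma>). skolem_tuple a \<sigma> (snd j)) (mset ?Q) \<in> snd (fst j)"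
      if "j \<in> J" for j
      using that unfolding J_def
    proof
      assume "j \<in> (\<lambda>i. ((2, equality_cluster), [Inl i, Inr (row i)])) ` {..<m}"
      then obtain i where j: "j = ((2, equality_cluster), [Inl i, Inr (row i)])" by blast
      have "map (\<lambda>(a, \<sigma>). skolem_tuple a \<sigma> (snd j)) ?Q = map (\<lambda>k. [M ! k ! i, M ! k ! i]) [0..<n]"
        by (simp add: j skolem_tuple_def row_def n_def)
      moreover have "map (\<lambda>k. [M ! k ! i, M ! k ! i]) [0..<n] \<prec> equality_cluster"
        by (auto simp: equality_cluster_def tuple_msets_def count_eq_zero_iff)
      ultimately show ?thesis by (simp only: j fst_conv snd_conv flip: mset_map)
    next
      assume "j \<in> {(C, map Inr h) | C h. C \<in> \<T> \<and> length h = fst C \<and> proj h \<prec> snd C}"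
      then obtain C h where "j = (C, map Inr h)" "proj h \<prec> snd C" by blast
      then show ?thesis
        by (simp only: flip: mset_map) (simp add: proj_def skolem_tuple_def comp_def)
    qed
    ultimately show ?thesis using M unfolding minor_cluster_def by blast
  qed
  moreover have "\<exists>f. (length M, f) \<in> polymorphisms \<T> \<and> b = apply_rows m f M"
    if b: "{#b#} \<in> minor_cluster m snd J fst" for b
  proof -
    obtain P where P: "image_mset fst P = {#b#}"
      "\<And>j. j \<in> J \<Longrightarrow> image_mset (\<lambda>(a, \<sigma>). skolem_tuple a \<sigma> (snd j)) P \<in> snd (fst j)"
      using b unfolding minor_cluster_def by blast
    \<comment> \<open>A single column has a single witnessing pair, and its Skolem map is the
      operation sought.\<close>
    then obtain f where "P = {#(b, f)#}"
      by (metis (no_types, lifting) msed_map_invR image_mset_is_empty_iff prod.collapse)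
    with P(2) have f: "\<And>j. j \<in> J \<Longrightarrow> {#skolem_tuple b f (snd j)#} \<in> snd (fst j)" by simp
    have "b = apply_rows m f M"
    proof (intro nth_equalityI)
      show len: "length b = length (apply_rows m f M)"
        using b by (auto simp: minor_cluster_def tuple_msets_def)
      fix i assume "i < length b"
      then have i: "i < m" by (simp add: len)
      then have "((2, equality_cluster), [Inl i, Inr (row i)]) \<in> J" by (simp add: J_def)
      from f[OF this] have "{#[b ! i, f (row i)]#} \<in> equality_cluster"
        by (simp add: skolem_tuple_def)
      then have "b ! i = f (row i)"
        by (auto simp: equality_cluster_def split: if_splits)
      with i show "b ! i = apply_rows m f M ! i" by (simp add: apply_rows_def row_def)
    qed
    moreover have "satisfies (n, f) C" if C: "C \<in> \<T>" for C
    proof -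
      obtain r \<Gamma> where r: "C = (r, \<Gamma>)" by (cases C)
      then have \<Gamma>: "is_cluster r \<Gamma>" using C cl by (auto simp: clusters_def)
      show ?thesis
        unfolding r satisfies_iff
      proof (intro allI impI, elim conjE)
        fix N S
        assume N: "length N = n" "mset N + S \<in> \<Gamma>"
        then have NS: "mset N + S \<in> tuple_msets r" using \<Gamma> by (auto simp: is_cluster_def)
        then have S: "S \<in> tuple_msets r" by (auto simp: tuple_msets_def)
        \<comment> \<open>The constraints control \<open>f\<close> only when no further columns
          remain. Dividing by the remaining columns \<open>S\<close> reduces to that case, and the
          quotient is again in \<open>\<T>\<close>.\<close>
        let ?C = "(r, quotient_cluster r \<Gamma> S)"
        let ?h = "map (\<lambda>i. map (\<lambda>a. a ! i) N) [0..<r]"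
        have "?C \<in> \<T>" using quot C S r by (auto simp: closed_under_quotients_def)
        moreover have "proj ?h = N"
          using NS N(1) by (auto intro!: nth_equalityI simp: proj_def tuple_msets_def)
        moreover have "N \<prec> quotient_cluster r \<Gamma> S"
          using N NS by (auto simp: quotient_cluster_def tuple_msets_def add.commute)
        ultimately have "?C \<in> \<T> \<and> length ?h = fst ?C \<and> proj ?h \<prec> snd ?C" by simp
        then have "(?C, map Inr ?h) \<in> J" unfolding J_def by blast
        from f[OF this] have "{#apply_rows r f N#} \<in> quotient_cluster r \<Gamma> S"
          by (simp add: skolem_tuple_def apply_rows_def comp_def)
        then show "add_mset (apply_rows r f N) S \<in> \<Gamma>"
          by (simp add: quotient_cluster_def)
      qed
    qed
    moreover from this have "(length M, f) \<in> polymorphisms \<T>"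
      using n by (simp add: polymorphisms_def n_def)
    ultimately show ?thesis by blast
  qed
  ultimately show ?thesis by (rule that[OF mem])
qed

section \<open>Clusters of bounded breadth\<close>

lemma bounded_invariant_cluster_mem:
  fixes \<T> :: "'a cluster set"
  assumes cl: "\<T> \<subseteq> clusters" and eq: "(2, equality_cluster) \<in> \<T>"
    and triv: "\<And>p. (1, trivial_cluster 1 p) \<in> \<T>"
    and minors: "closed_under_conj_minors \<T>" and un: "closed_under_unions \<T>"
    and quot: "closed_under_quotients \<T>" and divi: "closed_under_dividends \<T>"
    and \<Phi>: "is_cluster m \<Phi>" "\<Phi> \<subseteq> trivial_cluster m p"
    and sat: "\<And>n f. (n, f) \<in> polymorphisms \<T> \<Longrightarrow> satisfies (n, f) (m, \<Phi>)"
  shows "(m, \<Phi>) \<in> \<T>"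
  using \<Phi> sat
proof (induction p arbitrary: \<Phi>)
  case (0 \<Phi>)
  have m: "m \<ge> 1" using "0.prems"(1) by (simp add: is_cluster_def)
  have "\<Phi> = {} \<or> \<Phi> = trivial_cluster m 0"
    using "0.prems"(2) by (simp add: trivial_cluster_0 subset_singleton_iff)
  \<comment> \<open>The empty cluster is the union of the empty family.\<close>
  moreover have "(m, {}) \<in> \<T>"
    using un[unfolded closed_under_unions_def, rule_format, of m "{}"] m by simp
  ultimately show ?case
    using closed_under_conj_minors_trivial_cluster[OF minors triv m] by (elim disjE) simp_all
next
  case (Suc p \<Phi>)
  have m: "m \<ge> 1" and tup: "\<Phi> \<subseteq> tuple_msets m"
    using Suc.prems(1) by (auto simp: is_cluster_def)
  note triv' = closed_under_conj_minors_trivial_cluster[OF minors triv m]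
  have Un: "(m, \<Psi>\<^sub>1 \<union> \<Psi>\<^sub>2) \<in> \<T>" if "(m, \<Psi>\<^sub>1) \<in> \<T>" "(m, \<Psi>\<^sub>2) \<in> \<T>" for \<Psi>\<^sub>1 \<Psi>\<^sub>2
    using un[unfolded closed_under_unions_def, rule_format, of m "{\<Psi>\<^sub>1, \<Psi>\<^sub>2}"] m that by auto
  \<comment> \<open>A divisor with at least one column lowers the breadth bound from
    \<open>Suc p\<close> to \<open>p\<close>.\<close>
  have quot_mem: "(m, quotient_cluster m \<Phi> S) \<in> \<T>" if "size S \<ge> 1" for S
  proof (rule Suc.IH)
    show "is_cluster m (quotient_cluster m \<Phi> S)"
      by (rule is_cluster_quotient_cluster) (fact Suc.prems(1))
    show "quotient_cluster m \<Phi> S \<subseteq> trivial_cluster m p"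
      using Suc.prems(2) that by (fastforce simp: quotient_cluster_def trivial_cluster_def)
  qed (use Suc.prems(3) satisfies_quotient_cluster in blast)
  define \<Phi>' where "\<Phi>' = \<Phi> \<union> trivial_cluster m 1"
  have "is_cluster m \<Phi>'"
    unfolding \<Phi>'_def by (intro is_cluster_Un is_cluster_trivial_cluster Suc.prems m)
  moreover have "(m, quotient_cluster m \<Phi>' S) \<in> \<T>" if S: "S \<in> tuple_msets m" "size S \<ge> 1" for S
  proof -
    \<comment> \<open>Dividing the trivial cluster of breadth 1 by \<open>S\<close> leaves only the
      empty multiset if \<open>S\<close> is a single column, and nothing if \<open>S\<close> is
      larger.\<close>
    have "quotient_cluster m \<Phi>' S =
        quotient_cluster m \<Phi> S \<union> (if size S = 1 then trivial_cluster m 0 else {})"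
      using S unfolding quotient_cluster_def \<Phi>'_def trivial_cluster_def tuple_msets_def by auto
    with Un[OF quot_mem[OF S(2)] triv'] quot_mem[OF S(2)] show ?thesis by auto
  qed
  ultimately have \<Phi>': "(m, \<Phi>') \<in> \<T>"
    using divi unfolding closed_under_dividends_def \<Phi>'_def by blast
  have below: "\<exists>\<Psi>. (m, \<Psi>) \<in> \<T> \<and> S \<in> \<Psi> \<and> \<Psi> \<subseteq> \<Phi>" if S: "S \<in> \<Phi>" for S
  proof (cases "S = {#}")
    case True
    with S triv'[of 0] show ?thesis by (auto simp: trivial_cluster_0)
  next
    case False
    obtain M where M: "mset M = S" using ex_mset by blast
    have "length M \<ge> 1" "mset M \<in> tuple_msets m"
      using False S M tup by (auto simp: Suc_le_eq)
    then obtain \<Theta> where \<Theta>: "(m, \<Theta>) \<in> \<T>" "M \<prec> \<Theta>"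
      "\<And>b. {#b#} \<in> \<Theta> \<Longrightarrow> \<exists>f. (length M, f) \<in> polymorphisms \<T> \<and> b = apply_rows m f M"
      using ex_member_singletons_polymorphism_images[OF cl eq minors quot m] by metis
    \<comment> \<open>With no columns remaining, satisfaction takes the matrix \<open>M\<close> in
      \<open>\<Phi>\<close> to the single column \<open>b\<close>.\<close>
    have single: "{#b#} \<in> \<Phi>" if b: "{#b#} \<in> \<Theta>" for b
    proof -
      obtain f where f: "(length M, f) \<in> polymorphisms \<T>" "b = apply_rows m f M"
        using \<Theta>(3)[OF b] by blast
      from satisfiesD[OF Suc.prems(3)[OF f(1)], of M "{#}"] S M f(2) show ?thesis by simp
    qed
    have "{#} \<in> \<Phi>" using S Suc.prems(1) unfolding is_cluster_def by (metis empty_le)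
    \<comment> \<open>All that \<open>\<Phi>'\<close> adds to \<open>\<Phi>\<close> has at most one
      column, and for such multisets in \<open>\<Theta>\<close> membership in \<open>\<Phi>\<close>
      is already known.\<close>
    then have "\<Theta> \<inter> \<Phi>' \<subseteq> \<Phi>"
      using single unfolding \<Phi>'_def trivial_cluster_def
      by (auto simp: le_Suc_eq) (metis One_nat_def size_1_singleton_mset)
    moreover have "S \<in> \<Theta> \<inter> \<Phi>'" using S M \<Theta>(2) by (simp add: \<Phi>'_def)
    ultimately show ?thesis
      using closed_under_conj_minors_Int[OF minors cl \<Theta>(1) \<Phi>'] by blast
  qed
  have "(m, \<Union>{\<Psi>. (m, \<Psi>) \<in> \<T> \<and> \<Psi> \<subseteq> \<Phi>}) \<in> \<T>"
    using un[unfolded closed_under_unions_def, rule_format, of m "{\<Psi>. (m, \<Psi>) \<in> \<T> \<and> \<Psi> \<subseteq> \<Phi>}"] m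
    by simp
  moreover have "\<Union>{\<Psi>. (m, \<Psi>) \<in> \<T> \<and> \<Psi> \<subseteq> \<Phi>} = \<Phi>" using below by blast
  ultimately show ?case by (simp only:)
qed


section \<open>The characterization\<close>

text \<open>One inclusion is built into \<open>polymorphisms\<close>. For the other, truncating to
  breadth \<open>p\<close> preserves satisfaction because trivial clusters are satisfied by all
  operations of positive arity, and local closure reassembles the truncations.\<close>

lemma characterized_by_polymorphisms:
  fixes \<T> :: "'a cluster set"
  assumes cl: "\<T> \<subseteq> clusters" and local: "locally_closed \<T>"
    and eq: "(2, equality_cluster) \<in> \<T>" and triv: "\<And>p. (1, trivial_cluster 1 p) \<in> \<T>"
    and minors: "closed_under_conj_minors \<T>" and un: "closed_under_unions \<T>"
    and quot: "closed_under_quotients \<T>" and divi: "closed_under_dividends \<T>"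
  shows "characterized_by \<T> (polymorphisms \<T>)"
proof -
  have "(m, \<Phi>) \<in> \<T>"
    if \<Phi>: "is_cluster m \<Phi>" and sat: "\<And>n f. (n, f) \<in> polymorphisms \<T> \<Longrightarrow> satisfies (n, f) (m, \<Phi>)"
    for m \<Phi>
  proof -
    have m: "m \<ge> 1" using \<Phi> by (simp add: is_cluster_def)
    have "(m, \<Phi> \<inter> trivial_cluster m p) \<in> \<T>" for p
    proof (rule bounded_invariant_cluster_mem[OF cl eq triv minors un quot divi])
      show "is_cluster m (\<Phi> \<inter> trivial_cluster m p)"
        by (intro is_cluster_Int \<Phi> is_cluster_trivial_cluster m)
      show "\<Phi> \<inter> trivial_cluster m p \<subseteq> trivial_cluster m p" by blast
      fix n f assume f: "(n, f) \<in> polymorphisms \<T>"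
      then have "n \<ge> 1" by (simp add: polymorphisms_def)
      with sat[OF f] show "satisfies (n, f) (m, \<Phi> \<inter> trivial_cluster m p)"
        by (intro satisfies_Int satisfies_trivial_cluster)
    qed
    with local \<Phi> show ?thesis unfolding locally_closed_def by blast
  qed
  with cl show ?thesis
    unfolding characterized_by_def by (auto simp: polymorphisms_def clusters_def)
qed

section \<open>Closure properties of characterized sets\<close>

lemma satisfies_local:
  assumes n: "n \<ge> 1" and \<Phi>: "is_cluster m \<Phi>"
    and sat: "\<And>p. satisfies (n, f) (m, \<Phi> \<inter> trivial_cluster m p)"
  shows "satisfies (n, f) (m, \<Phi>)"
  unfolding satisfies_iff
proof (intro allI impI, elim conjE)
  fix M S assume M: "length M = n" "mset M + S \<in> \<Phi>"
  \<comment> \<open>One instance of satisfaction involves a single finite matrix, whose number of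
    columns is the breadth to use.\<close>
  then have "mset M + S \<in> \<Phi> \<inter> trivial_cluster m (size (mset M + S))"
    using \<Phi> by (auto simp: is_cluster_def trivial_cluster_def)
  from satisfiesD[OF sat this M(1)] show "add_mset (apply_rows m f M) S \<in> \<Phi>" by blast
qed

text \<open>Membership in \<open>\<T>\<close> is tested one operation at a time, so each property
  reduces to a preservation result for a single \<open>f\<close>; positive arity enters through the
  trivial clusters.\<close>

lemma closure_properties_if_characterized_by:
  fixes \<T> :: "'a cluster set"
  assumes arity: "\<forall>(n, f) \<in> \<F>. n \<ge> 1" and char: "characterized_by \<T> \<F>"
  shows "locally_closed \<T>" "(2, equality_cluster) \<in> \<T>" "(1, {}) \<in> \<T>"
    "(1, trivial_cluster 1 p) \<in> \<T>" "closed_under_conj_minors \<T>" "closed_under_unions \<T>"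
    "closed_under_quotients \<T>" "closed_under_dividends \<T>"
proof -
  have pos: "\<And>n f. (n, f) \<in> \<F> \<Longrightarrow> n \<ge> 1" using arity by blast
  have mem: "(m, \<Phi>) \<in> \<T> \<longleftrightarrow>
      is_cluster m \<Phi> \<and> (\<forall>(n, f) \<in> \<F>. satisfies (n, f) (m, \<Phi>))" for m \<Phi>
    using char unfolding characterized_by_def clusters_def by auto
  show "locally_closed \<T>"
    unfolding locally_closed_def mem using pos by (blast intro: satisfies_local)
  show "(2, equality_cluster) \<in> \<T>"
    using is_cluster_equality_cluster satisfies_equality_cluster by (auto simp: mem)
  show "(1, {}) \<in> \<T>" by (auto simp: mem is_cluster_def satisfies_iff)
  show "(1, trivial_cluster 1 p) \<in> \<T>"
    unfolding mem using pos by (blast intro: is_cluster_trivial_cluster satisfies_trivial_cluster order.refl)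
  show "closed_under_unions \<T>"
    unfolding closed_under_unions_def mem
  proof (intro allI impI, elim conjE, intro conjI)
    fix m X assume m: "m \<ge> 1"
      and X: "\<forall>\<Phi> \<in> X. is_cluster m \<Phi> \<and> (\<forall>(n, f) \<in> \<F>. satisfies (n, f) (m, \<Phi>))"
    show "is_cluster m (\<Union>X)" using m X by (simp add: is_cluster_Union)
    show "\<forall>(n, f) \<in> \<F>. satisfies (n, f) (m, \<Union>X)"
      using X by (blast intro: satisfies_Union)
  qed
  show "closed_under_quotients \<T>"
    unfolding closed_under_quotients_def mem
    using is_cluster_quotient_cluster satisfies_quotient_cluster by blast
  show "closed_under_dividends \<T>"
    unfolding closed_under_dividends_def mem using satisfies_dividend by blast
  show "closed_under_conj_minors \<T>"
    unfolding closed_under_conj_minors_def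
  proof (intro allI impI, elim conjE)
    fix J :: "'a index set" and \<Psi> C
    assume J: "\<forall>j \<in> J. \<Psi> j \<in> \<T>" and "conj_minor J \<Psi> C"
    then obtain V :: "'a indet set" and h where via: "conj_minor_via V h J \<Psi> C"
      unfolding conj_minor_def by blast
    obtain m \<Phi> where C: "C = (m, \<Phi>)" by (cases C)
    have "satisfies (n, f) (m, \<Phi>)" if "(n, f) \<in> \<F>" for n f
      using J char that unfolding characterized_by_def
      by (intro satisfies_conj_minor_via[OF via[unfolded C]]) auto
    with via show "C \<in> \<T>" unfolding C mem conj_minor_via_def by auto
  qed
qed

theorem theorem6p6:
  fixes \<T> :: "'a cluster set"
  assumes "\<T> \<subseteq> clusters"
  shows
    "(locally_closed \<T> \<and>
      (2, equality_cluster) \<in> \<T> \<and>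
      (1, {}) \<in> \<T> \<and>
      (\<forall>p. (1, trivial_cluster 1 p) \<in> \<T>) \<and>
      closed_under_conj_minors \<T> \<and>
      closed_under_unions \<T> \<and>
      closed_under_quotients \<T> \<and>
      closed_under_dividends \<T>)
     \<longleftrightarrow> (\<exists>\<F> :: 'a operation set. (\<forall>(n, f) \<in> \<F>. n \<ge> 1) \<and> characterized_by \<T> \<F>)"
    (is "?closed \<longleftrightarrow> ?char")
proof
  assume ?closed
  then have "characterized_by \<T> (polymorphisms \<T>)"
    by (intro characterized_by_polymorphisms assms) simp_all
  moreover have "\<forall>(n, f) \<in> polymorphisms \<T>. n \<ge> 1" by (auto simp: polymorphisms_def)
  ultimately show ?char by blast
next
  assume ?char
  then obtain \<F> :: "'a operation set" where \<F>: "\<forall>(n, f) \<in> \<F>. n \<ge> 1" "characterized_by \<T> \<F>"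
    by blast
  show ?closed
    using closure_properties_if_characterized_by[OF \<F>] by blast
qed

end
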